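(* Let $r\in(1,2]$, $L>0$, $\sigma>0$, and consider $y_i=f(x_i)+\sigma\epsilon_i$, $x_i=i/n$, $i=1,\dots,n$, with $\epsilon_i$ independent standard normal. Let $\bar\lambda>0$ be a constant for which (together with some $P\in\mathbb N$) the uniform Lipschitz property stated in the context holds. Let $\lambda\in(0,\bar\lambda]$ (possibly depending on $n$), and let $K_n$ satisfy $n/K_n\to\infty$ and $K_n/(n^{\frac1{2r+1}}\sqrt{\log n})\to0$ as $n\to\infty$. Then there exists a positive constant $C_3$ such that for all $n$ sufficiently large (uniformly in $f$), $$\sup_{f\in\mathcal C_H(r,L)}\mathbb E\Big(\|\hat f^{[1]}-\bar f^{[1]}\|_\infty\Big)\le C_3\left(\frac{K_n\log n}n\right)^{1/2},$$ where $\hat f^{[1]}$ and $\bar f^{[1]}$ are the convex $P$-splines built from the noisy data $y_i$ and the noise-free data $f(x_i)$ respectively, as defined in the context.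
   Context: $\mathcal C_H(r,L)$ is the set of differentiable convex functions $f:[0,1]\to\mathbb R$ with $|f'(x_1)-f'(x_2)|\le L|x_1-x_2|^{r-1}$ for all $x_1,x_2\in[0,1]$. $\|g\|_\infty=\sup_{x\in[0,1]}|g(x)|$. Standing assumption: $K_n\ge2$ is an integer and $n/K_n$ is an integer (so $n$ ranges over an infinite set of positive integers on which this holds). The linear B-spline basis with knots $k/K_n$ is $B^{[1]}_k(x)=\max\{0,\,1-|K_nx-(k-1)|\}$, $x\in[0,1]$, $k=1,\dots,K_n+1$. Let $X=[B^{[1]}_k(x_i)]_{i,k}\in\mathbb R^{n\times(K_n+1)}$, $\beta_n:=\sum_{i=1}^n(B^{[1]}_k(x_i))^2$ for $k\in\{2,\dots,K_n\}$ (independent of such $k$), $\Gamma:=X^TX/\beta_n$, $D_2\in\mathbb R^{(K_n-1)\times(K_n+1)}$ with $(D_2b)_i=b_i-2b_{i+1}+b_{i+2}$, $\Lambda:=\Gamma+\lambda D_2^TD_2$, $\Omega:=\{b\in\mathbb R^{K_n+1}:D_2b\ge0\}$ (componentwise). For $\bar y\in\mathbb R^{K_n+1}$ let $\hat b(\bar y):=\arg\min_{b\in\Omega}\frac12b^T\Lambda b-b^T\bar y$. Uniform Lipschitz property (proved separately in the paper; such constants exist): there are $P\in\mathbb N$ and $\kappa_\infty>0$, independent of $n,K_n,\lambda$, such that for all $\lambda\in[0,\bar\lambda]$ and all $K_n$ with $n/K_n\ge P$, $\|\hat b(\bar y^1)-\hat b(\bar y^2)\|_\infty\le\kappa_\infty\|\bar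 y^1-\bar y^2\|_\infty$ for all $\bar y^1,\bar y^2\in\mathbb R^{K_n+1}$. With $y=(y_1,\dots,y_n)^T$ and $\vec f=(f(x_1),\dots,f(x_n))^T$, put $\hat f^{[1]}(x):=\sum_{k=1}^{K_n+1}\hat b_k(X^Ty/\beta_n)B^{[1]}_k(x)$ and $\bar f^{[1]}(x):=\sum_{k=1}^{K_n+1}\hat b_k(X^T\vec f/\beta_n)B^{[1]}_k(x)$. *)

theory Defs
  imports "HOL-Probability.Probability" "Jordan_Normal_Form.Matrix"
begin

(* Both HOL-Analysis and Jordan_Normal_Form claim these infix symbols; here they are matrix notation. *)
no_notation inner (infix "\<bullet>" 70)
no_notation Finite_Cartesian_Product.vec_nth (infixl "$" 90)
hide_const (open) Finite_Cartesian_Product.vec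
hide_type (open) Finite_Cartesian_Product.vec

(* The derivative is the one relative to [0,1], i.e. one-sided at the end points; only the values
   of f on [0,1] matter. *)
definition holder_convex :: "real \<Rightarrow> real \<Rightarrow> (real \<Rightarrow> real) set" where
  "holder_convex r L = {f. convex_on {0..1} f \<and>
     (\<exists>f'. (\<forall>x\<in>{0..1}. (f has_real_derivative f' x) (at x within {0..1})) \<and>
           (\<forall>x1\<in>{0..1}. \<forall>x2\<in>{0..1}. \<bar>f' x1 - f' x2\<bar> \<le> L * \<bar>x1 - x2\<bar> powr (r - 1)))}"

definition sup_norm :: "(real \<Rightarrow> real) \<Rightarrow> real" where
  "sup_norm g = (SUP x\<in>{0..1}. \<bar>g x\<bar>)"

definition vec_sup_norm :: "real vec \<Rightarrow> real" where
  "vec_sup_norm v = Max ((\<lambda>i. \<bar>v $ i\<bar>) ` {..<dim_vec v})"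

definition bspline1 :: "nat \<Rightarrow> nat \<Rightarrow> real \<Rightarrow> real" where
  "bspline1 K k x = max 0 (1 - \<bar>real K * x - (real k - 1)\<bar>)"

definition design_point :: "nat \<Rightarrow> nat \<Rightarrow> real" where
  "design_point n i = real i / real n"

(* Matrices and vectors are indexed from 0, so B-spline k and design point i (both counted from 1)
   sit at positions k - 1 and i - 1. *)
definition design_matrix :: "nat \<Rightarrow> nat \<Rightarrow> real mat" where
  "design_matrix n K = mat n (K + 1) (\<lambda>(i, k). bspline1 K (k + 1) (design_point n (i + 1)))"

(* Any interior index k gives the same value, see beta_interior. *)
definition beta :: "nat \<Rightarrow> nat \<Rightarrow> real" where
  "beta n K = (\<Sum>i=1..n. (bspline1 K 2 (design_point n i))\<^sup>2)"

definition Gamma_mat :: "nat \<Rightarrow> nat \<Rightarrow> real mat" where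
  "Gamma_mat n K = (1 / beta n K) \<cdot>\<^sub>m (transpose_mat (design_matrix n K) * design_matrix n K)"

definition second_diff :: "nat \<Rightarrow> real mat" where
  "second_diff K = mat (K - 1) (K + 1)
     (\<lambda>(i, j). if j = i then 1 else if j = i + 1 then - 2 else if j = i + 2 then 1 else 0)"

definition Lambda_mat :: "nat \<Rightarrow> nat \<Rightarrow> real \<Rightarrow> real mat" where
  "Lambda_mat n K lam =
     Gamma_mat n K + lam \<cdot>\<^sub>m (transpose_mat (second_diff K) * second_diff K)"

definition Omega :: "nat \<Rightarrow> real vec set" where
  "Omega K = {b \<in> carrier_vec (K + 1). 0\<^sub>v (K - 1) \<le> second_diff K *\<^sub>v b}"

definition b_hat :: "nat \<Rightarrow> nat \<Rightarrow> real \<Rightarrow> real vec \<Rightarrow> real vec" where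
  "b_hat n K lam ybar =
     arg_min_on (\<lambda>b. 1 / 2 * (b \<bullet> (Lambda_mat n K lam *\<^sub>v b)) - b \<bullet> ybar) (Omega K)"

definition uniform_lipschitz :: "real \<Rightarrow> nat \<Rightarrow> real \<Rightarrow> bool" where
  "uniform_lipschitz lambar P kappa \<longleftrightarrow>
     (\<forall>n K. n \<ge> 1 \<longrightarrow> K \<ge> 2 \<longrightarrow> K dvd n \<longrightarrow> n div K \<ge> P \<longrightarrow>
       (\<forall>lam\<in>{0..lambar}. \<forall>ybar1\<in>carrier_vec (K + 1). \<forall>ybar2\<in>carrier_vec (K + 1).
          vec_sup_norm (b_hat n K lam ybar1 - b_hat n K lam ybar2)
            \<le> kappa * vec_sup_norm (ybar1 - ybar2)))"

(* The convex P-spline built from the data vector y. *)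
definition pspline :: "nat \<Rightarrow> nat \<Rightarrow> real \<Rightarrow> real vec \<Rightarrow> real \<Rightarrow> real" where
  "pspline n K lam y x =
     (\<Sum>k=1..K + 1.
        b_hat n K lam ((1 / beta n K) \<cdot>\<^sub>v (transpose_mat (design_matrix n K) *\<^sub>v y)) $ (k - 1)
          * bspline1 K k x)"

definition exact_data :: "nat \<Rightarrow> (real \<Rightarrow> real) \<Rightarrow> real vec" where
  "exact_data n f = vec n (\<lambda>i. f (design_point n (i + 1)))"

definition noisy_data :: "nat \<Rightarrow> (real \<Rightarrow> real) \<Rightarrow> real \<Rightarrow> (nat \<Rightarrow> real) \<Rightarrow> real vec" where
  "noisy_data n f \<sigma> e = vec n (\<lambda>i. f (design_point n (i + 1)) + \<sigma> * e (i + 1))"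

lemma beta_interior:
  assumes "n \<ge> 1" "K dvd n" "k \<in> {2..K}"
  shows "(\<Sum>i=1..n. (bspline1 K k (design_point n i))\<^sup>2) = beta n K"
proof -
  obtain m where n: "n = K * m" using assms(2) by (auto simp: dvd_def)
  have m: "m > 0" and K: "K > 0" using assms(1) n by (auto intro: Nat.gr0I)
  define T :: "real \<Rightarrow> real" where "T = (\<lambda>t. (max 0 (1 - \<bar>t\<bar>))\<^sup>2)"
  have eq: "(bspline1 K j (design_point n i))\<^sup>2 = T (real i / real m - (real j - 1))" for i j
    using K by (simp add: bspline1_def design_point_def T_def n)
  have main: "(\<Sum>i=1..n. (bspline1 K j (design_point n i))\<^sup>2) = (\<Sum>i=1..2*m. T (real i / real m - 1))"
    if j: "j \<in> {2..K}" for j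
  proof -
    define c where "c = (j - 2) * m"
    have cr: "real c = (real j - 2) * real m" using j by (simp add: c_def of_nat_diff)
    have "c + 2 * m = j * m" using j by (simp add: c_def algebra_simps flip: add_mult_distrib2)
    also have "\<dots> \<le> n" using j by (simp add: n)
    finally have sub: "{1 + c..2 * m + c} \<subseteq> {1..n}" by auto
    have zero: "T (real i / real m - (real j - 1)) = 0" if "i \<in> {1..n} - {1 + c..2 * m + c}" for i
    proof -
      have "i \<le> c \<or> i \<ge> 2 * m + c" using that by auto
      hence "real i \<le> real c \<or> real i \<ge> 2 * real m + real c" by linarith
      hence "real i \<le> (real j - 2) * real m \<or> real i \<ge> real j * real m"
        using cr by (auto simp: algebra_simps)
      hence "real i / real m \<le> real j - 2 \<or> real i / real m \<ge> real j"
        using m by (auto simp: field_simps)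
      thus ?thesis by (auto simp: T_def)
    qed
    have "(\<Sum>i=1..n. (bspline1 K j (design_point n i))\<^sup>2)
        = (\<Sum>i=1 + c..2 * m + c. T (real i / real m - (real j - 1)))"
      unfolding eq using sub zero by (intro sum.mono_neutral_right) auto
    also have "\<dots> = (\<Sum>i=1..2 * m. T (real (i + c) / real m - (real j - 1)))"
      by (rule sum.shift_bounds_cl_nat_ivl)
    also have "\<dots> = (\<Sum>i=1..2 * m. T (real i / real m - 1))"
      using m by (intro sum.cong refl arg_cong[where f = T]) (simp add: cr field_simps)
    finally show ?thesis .
  qed
  have "2 \<in> {2..K}" using assms(3) by auto
  thus ?thesis using main[OF assms(3)] main[of 2] by (simp add: beta_def)
qed

end

(* The B-splines are a partition of unity equal to 1 at their own knot, so the sup norm of a linear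
   spline is the maximal coefficient. The uniform Lipschitz property therefore reduces the claim to
   bounding the expected maximum of the K + 1 centred Gaussian variables that form X^T (y - f) / beta,
   each of variance O(K / n) because beta >= n / (8 K). Their exponential moments give a maximum of
   order sqrt (K log n / n). *)
theory Submission
  imports Defs
begin

text \<open>The function \<open>f\<close> cancels: noisy and exact data lead to arguments of
  \<open>b_hat\<close> that differ by weighted noise alone, so one bound serves every
  \<open>f\<close>. Neighbouring splines overlap, so the Gaussians may be correlated; replacing
  their maximum by a sum of exponentials is insensitive to this and costs only ln (2 (K + 1)), at
  most 3 ln n because K \<le> n. Two points hide behind the Lipschitz reduction.
  \<open>b_hat\<close> is a choice among minimizers, so its length is known only once a minimizer
  exists; existence rests on the penalty, since the data term may miss the coefficient at knot 0.
  And the error must be shown to be a random variable although \<open>b_hat\<close> has no formula: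
  the Lipschitz property, used a second time, makes it continuous in the data. The final constant is
  48 times \<open>\<sigma>\<close> times the Lipschitz constant.\<close>

text \<open>Tychonoff's theorem for the topology that functions carry as a type; it makes boxes of
  coefficient functions compact.\<close>

lemma compact_PiE_UNIV:
  fixes S :: "'i \<Rightarrow> 'b::topological_space set"
  assumes "\<And>i. compact (S i)"
  shows "compact (PiE UNIV S)"
  using assms by (metis UNIV_I compactin_PiE compactin_euclidean_iff euclidean_product_topology)

section \<open>Exponential moments of Gaussians and the expected maximum\<close>

text \<open>Completing the square, t x - x^2 / 2 = t^2 / 2 - (x - t)^2 / 2, turns the tilted density
  into a multiple of the normal density with mean \<open>t\<close>.\<close>

lemma mgf_std_normal:
  "(\<integral>\<^sup>+x. ennreal (std_normal_density x) * ennreal (exp (t * x)) \<partial>lborel) = ennreal (exp (t\<^sup>2 / 2))"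
proof -
  have "std_normal_density x * exp (t * x) = exp (t\<^sup>2 / 2) * normal_density t 1 x" for x
    by (simp add: std_normal_density_def normal_density_def power2_eq_square field_simps flip: exp_add)
  then have "(\<integral>\<^sup>+x. ennreal (std_normal_density x) * ennreal (exp (t * x)) \<partial>lborel)
      = (\<integral>\<^sup>+x. ennreal (exp (t\<^sup>2 / 2)) * ennreal (normal_density t 1 x) \<partial>lborel)"
    by (simp flip: ennreal_mult)
  also have "\<dots> = ennreal (exp (t\<^sup>2 / 2))"
    by (simp add: nn_integral_cmult nn_integral_eq_integral)
  finally show ?thesis .
qed

text \<open>By independence the integral of the product of exponentials is the product of their
  integrals, and the exponents (a_i)^2 / 2 add up.\<close>

lemma (in prob_space) mgf_normal_combination:
  assumes "finite I" "indep_vars (\<lambda>_. borel) e I"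
    and "\<And>i. i \<in> I \<Longrightarrow> distributed M lborel (e i) (\<lambda>x. ennreal (std_normal_density x))"
  shows "(\<integral>\<^sup>+\<omega>. ennreal (exp (\<Sum>i\<in>I. a i * e i \<omega>)) \<partial>M) = ennreal (exp ((\<Sum>i\<in>I. (a i)\<^sup>2) / 2))"
proof -
  have ind: "indep_vars (\<lambda>_. borel) (\<lambda>i \<omega>. ennreal (exp (a i * e i \<omega>))) I"
    by (rule indep_vars_compose2[OF assms(2)]) measurable
  have one: "(\<integral>\<^sup>+\<omega>. ennreal (exp (a i * e i \<omega>)) \<partial>M) = ennreal (exp ((a i)\<^sup>2 / 2))" if "i \<in> I" for i
    using distributed_nn_integral[OF assms(3)[OF that], of "\<lambda>x. ennreal (exp (a i * x))"]
    by (simp add: mgf_std_normal)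
  have "(\<integral>\<^sup>+\<omega>. ennreal (exp (\<Sum>i\<in>I. a i * e i \<omega>)) \<partial>M)
      = (\<integral>\<^sup>+\<omega>. (\<Prod>i\<in>I. ennreal (exp (a i * e i \<omega>))) \<partial>M)"
    by (simp add: exp_sum assms(1) prod_ennreal)
  also have "\<dots> = (\<Prod>i\<in>I. ennreal (exp ((a i)\<^sup>2 / 2)))"
    by (subst indep_vars_nn_integral[OF assms(1) ind]) (simp_all add: one)
  also have "\<dots> = ennreal (exp ((\<Sum>i\<in>I. (a i)\<^sup>2) / 2))"
    by (simp add: prod_ennreal assms(1) exp_sum[symmetric] sum_divide_distrib)
  finally show ?thesis .
qed

text \<open>With \<open>A = 2 * card J * exp (t\<^sup>2 * v / 2)\<close>, the tangent line of the logarithm at \<open>A\<close> gives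
  \<open>t * x \<le> ln A - 1 + exp (t * x) / A\<close>; the maximum is replaced by the sum over all \<open>\<plusminus>\<xi>\<^sub>j\<close>.\<close>
lemma (in prob_space) expectation_Max_subgaussian:
  fixes \<xi> :: "'j \<Rightarrow> 'a \<Rightarrow> real"
  assumes J: "finite J" "card J \<ge> 2" and t: "t > 0"
    and [measurable]: "\<And>j. j \<in> J \<Longrightarrow> \<xi> j \<in> borel_measurable M"
    and mgf: "\<And>j u. j \<in> J \<Longrightarrow> \<bar>u\<bar> = t \<Longrightarrow>
                (\<integral>\<^sup>+\<omega>. ennreal (exp (u * \<xi> j \<omega>)) \<partial>M) \<le> ennreal (exp (t\<^sup>2 * v / 2))"
    and v: "v \<ge> 0"
  shows "(\<integral>\<^sup>+\<omega>. ennreal (Max ((\<lambda>j. \<bar>\<xi> j \<omega>\<bar>) ` J)) \<partial>M) \<le> ennreal (ln (2 * card J) / t + t * v / 2)"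
proof -
  define A where "A = 2 * card J * exp (t\<^sup>2 * v / 2)"
  have "real (2 * card J) * 1 \<le> A" unfolding A_def using v by (intro mult_left_mono) auto
  then have A: "A \<ge> 4" using J by linarith
  \<comment> \<open>As \<open>A \<ge> 4\<close> exceeds e, the constant (ln A - 1) / t is
    nonnegative, and \<open>ennreal\<close> of the sum below may be split. With a single index
    \<open>A\<close> could be as small as 2.\<close>
  have "ln A \<ge> ln (exp 1)" using A exp_le by (subst ln_le_cancel_iff) auto
  then have lnA: "ln A \<ge> 1" by simp
  define S where "S \<omega> = (\<Sum>j\<in>J. exp (t * \<xi> j \<omega>) + exp (- t * \<xi> j \<omega>))" for \<omega>
  have ne: "J \<noteq> {}" using J by auto
  have S0: "S \<omega> \<ge> 0" for \<omega> unfolding S_def by (intro sum_nonneg) (simp add: add_nonneg_nonneg)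
  have pt: "Max ((\<lambda>j. \<bar>\<xi> j \<omega>\<bar>) ` J) \<le> (ln A - 1) / t + S \<omega> / (A * t)" for \<omega>
  proof (rule Max.boundedI)
    fix x assume "x \<in> (\<lambda>j. \<bar>\<xi> j \<omega>\<bar>) ` J"
    then obtain j where j: "j \<in> J" and x: "x = \<bar>\<xi> j \<omega>\<bar>" by auto
    have "exp (t * x) \<le> exp (t * \<xi> j \<omega>) + exp (- t * \<xi> j \<omega>)"
      by (cases "\<xi> j \<omega> \<ge> 0") (auto simp: x)
    also have "\<dots> \<le> S \<omega>" unfolding S_def
      by (rule member_le_sum[OF j]) (auto simp: J add_nonneg_nonneg)
    finally have le: "exp (t * x) \<le> S \<omega>" .
    have "t * x - ln A = ln (exp (t * x) / A)" using A by (simp add: ln_div)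
    also have "\<dots> \<le> exp (t * x) / A - 1" using A by (intro ln_le_minus_one) auto
    also have "\<dots> \<le> S \<omega> / A - 1" using le A by (simp add: divide_right_mono)
    finally have "t * x \<le> ln A - 1 + S \<omega> / A" by simp
    then have "x \<le> (ln A - 1 + S \<omega> / A) / t" using t by (simp add: field_simps)
    then show "x \<le> (ln A - 1) / t + S \<omega> / (A * t)" by (simp add: add_divide_distrib)
  qed (use J ne in auto)
  have [measurable]: "S \<in> borel_measurable M" unfolding S_def by measurable
  have "(\<integral>\<^sup>+\<omega>. ennreal (S \<omega>) \<partial>M)
      = (\<Sum>j\<in>J. (\<integral>\<^sup>+\<omega>. ennreal (exp (t * \<xi> j \<omega>)) \<partial>M) + (\<integral>\<^sup>+\<omega>. ennreal (exp (- t * \<xi> j \<omega>)) \<partial>M))"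
    unfolding S_def
    by (subst sum_ennreal[symmetric]) (auto simp: add_nonneg_nonneg nn_integral_sum nn_integral_add)
  also have "\<dots> \<le> (\<Sum>j\<in>J. ennreal (exp (t\<^sup>2 * v / 2)) + ennreal (exp (t\<^sup>2 * v / 2)))"
    using t by (intro sum_mono add_mono mgf) auto
  also have "\<dots> = ennreal A"
    by (simp add: A_def ennreal_of_nat_eq_real_of_nat mult.commute
        flip: ennreal_plus ennreal_mult'')
  finally have ES: "(\<integral>\<^sup>+\<omega>. ennreal (S \<omega>) \<partial>M) \<le> ennreal A" .
  have "(\<integral>\<^sup>+\<omega>. ennreal (Max ((\<lambda>j. \<bar>\<xi> j \<omega>\<bar>) ` J)) \<partial>M)
      \<le> (\<integral>\<^sup>+\<omega>. ennreal ((ln A - 1) / t) + ennreal (1 / (A * t)) * ennreal (S \<omega>) \<partial>M)"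
  proof (intro nn_integral_mono)
    fix \<omega>
    have "ennreal (Max ((\<lambda>j. \<bar>\<xi> j \<omega>\<bar>) ` J)) \<le> ennreal ((ln A - 1) / t + 1 / (A * t) * S \<omega>)"
      using pt[of \<omega>] by (intro ennreal_leI) simp
    then show "ennreal (Max ((\<lambda>j. \<bar>\<xi> j \<omega>\<bar>) ` J))
        \<le> ennreal ((ln A - 1) / t) + ennreal (1 / (A * t)) * ennreal (S \<omega>)"
      using A t lnA S0[of \<omega>] by (simp add: ennreal_mult'[symmetric] ennreal_plus[symmetric] del: ennreal_plus)
  qed
  also have "\<dots> = ennreal ((ln A - 1) / t) + ennreal (1 / (A * t)) * (\<integral>\<^sup>+\<omega>. ennreal (S \<omega>) \<partial>M)"
    by (simp add: nn_integral_add nn_integral_cmult emeasure_space_1)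
  also have "\<dots> \<le> ennreal ((ln A - 1) / t) + ennreal (1 / (A * t)) * ennreal A"
    by (intro add_left_mono mult_left_mono ES) auto
  also have "\<dots> = ennreal ((ln A - 1) / t + 1 / (A * t) * A)"
    by (subst ennreal_mult'[symmetric], use A t in simp, subst ennreal_plus[symmetric])
      (use A t lnA in auto)
  \<comment> \<open>\<open>A\<close> bounds the expectation of \<open>S\<close>, so the second term
    is 1 / t and cancels the -1 of the tangent line.\<close>
  also have "(ln A - 1) / t + 1 / (A * t) * A = ln A / t"
    using A by (simp add: diff_divide_distrib)
  also have "ln A / t = ln (2 * card J) / t + t * v / 2"
    using t J ne by (simp add: A_def ln_mult field_simps power2_eq_square)
  finally show ?thesis .
qed

section \<open>Locality of the linear B-splines and sup norms of splines\<close>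

lemma bspline1_knot:
  assumes "K \<ge> 1" "k \<ge> 1"
  shows "bspline1 K k (real j / real K) = (if k = Suc j then 1 else 0)"
proof -
  have "\<bar>real j - (real k - 1)\<bar> \<ge> 1" if "k \<noteq> Suc j"
    using that by linarith
  then show ?thesis using assms by (auto simp: bspline1_def max_def)
qed

lemma bspline1_nonneg: "bspline1 K k x \<ge> 0"
  by (simp add: bspline1_def)

lemma bspline1_le_1: "bspline1 K k x \<le> 1"
  by (simp add: bspline1_def)

text \<open>For p \<le> K x < p + 1 only the splines p + 1 and p + 2 can be nonzero; their values
  are 1 - (K x - p) and K x - p.\<close>

lemma sum_bspline1_le_1:
  assumes "x \<ge> 0"
  shows "(\<Sum>k=1..K + 1. bspline1 K k x) \<le> 1"
proof -
  define p where "p = nat \<lfloor>real K * x\<rfloor>"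
  have "real K * x \<ge> 0" using assms by simp
  then have p: "real p \<le> real K * x" "real K * x < real p + 1"
    unfolding p_def by linarith+
  have zero: "bspline1 K k x = 0" if "k \<noteq> p + 1" "k \<noteq> p + 2" for k
  proof -
    have "real k \<le> real p \<or> real k \<ge> real p + 3" using that by linarith
    then show ?thesis using p by (auto simp: bspline1_def)
  qed
  \<comment> \<open>At x = 1 the index p + 2 is K + 2, outside the basis. Adding the missing
    nonnegative terms avoids a case distinction and is the reason for stating an inequality.\<close>
  have "(\<Sum>k=1..K + 1. bspline1 K k x) \<le> (\<Sum>k\<in>{1..K + 1} \<union> {p + 1, p + 2}. bspline1 K k x)"
    by (intro sum_mono2) (auto simp: bspline1_nonneg)
  also have "\<dots> = (\<Sum>k\<in>{p + 1, p + 2}. bspline1 K k x)"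
    using zero by (intro sum.mono_neutral_right) auto
  also have "\<dots> = 1" using p by (simp add: bspline1_def)
  finally show ?thesis .
qed

lemma sup_norm_spline:
  assumes "K \<ge> 1"
  shows "sup_norm (\<lambda>x. \<Sum>k=1..K + 1. c (k - 1) * bspline1 K k x) = Max ((\<lambda>k. \<bar>c k\<bar>) ` {..<K + 1})"
    (is "sup_norm ?s = ?m")
  unfolding sup_norm_def
proof (rule cSup_eq_maximum)
  have "?m \<in> (\<lambda>k. \<bar>c k\<bar>) ` {..<K + 1}" by (intro Max_in) auto
  then obtain j where j: "j < K + 1" "?m = \<bar>c j\<bar>" by auto
  have "?s (real j / real K) = (\<Sum>k=1..K + 1. if k = Suc j then c j else 0)"
    using assms by (intro sum.cong) (auto simp: bspline1_knot)
  also have "\<dots> = c j" using j by simp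
  finally have "?s (real j / real K) = c j" .
  then have "?m = \<bar>?s (real j / real K)\<bar>" using j(2) by simp
  then show "?m \<in> (\<lambda>x. \<bar>?s x\<bar>) ` {0..1}" by (rule image_eqI) (use j assms in \<open>auto simp: field_simps\<close>)
next
  fix y assume "y \<in> (\<lambda>x. \<bar>?s x\<bar>) ` {0..1}"
  then obtain x where x: "x \<in> {0..1}" "y = \<bar>?s x\<bar>" by auto
  have m: "\<bar>c k\<bar> \<le> ?m" if "k < K + 1" for k using that by (intro Max_ge) auto
  have "y \<le> (\<Sum>k=1..K + 1. \<bar>c (k - 1) * bspline1 K k x\<bar>)"
    unfolding x(2) by (rule sum_abs)
  also have "\<dots> \<le> (\<Sum>k=1..K + 1. ?m * bspline1 K k x)"
    by (intro sum_mono) (auto simp: abs_mult bspline1_nonneg intro!: mult_right_mono m)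
  also have "\<dots> = ?m * (\<Sum>k=1..K + 1. bspline1 K k x)" by (rule sum_distrib_left[symmetric])
  also have "\<dots> \<le> ?m * 1"
    using x order_trans[OF abs_ge_zero m[of 0]] sum_bspline1_le_1[of x K]
    by (intro mult_left_mono) simp_all
  finally show "y \<le> ?m" by simp
qed

section \<open>Sums of squared B-splines over the design points\<close>

text \<open>\<open>m\<close> = n / K is the number of design points per knot interval; in units of
  such an interval, x_i lies at i / m.\<close>

lemma bspline1_design_eq:
  assumes "n \<ge> 1" "n = K * m"
  shows "bspline1 K k (design_point n i) = max 0 (1 - \<bar>real i / real m - (real k - 1)\<bar>)"
  using assms by (simp add: bspline1_def design_point_def)

text \<open>On m \<le> i \<le> 3 m / 2, the half interval to the right of its knot, the second
  spline is at least 1 / 2. There are at least m / 2 such indices, and each contributes at least 1 /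
  4.\<close>

lemma beta_ge:
  assumes "n \<ge> 1" "n = K * m" "K \<ge> 2"
  shows "beta n K \<ge> real m / 8"
proof -
  have m: "m \<ge> 1" using assms by (cases m) auto
  have "2 * m \<le> n" using assms by simp
  then have sub: "{m..m + m div 2} \<subseteq> {1..n}" using m by auto
  have "real m / 8 \<le> (\<Sum>i=m..m + m div 2. 1 / 4)" by simp
  also have "\<dots> \<le> (\<Sum>i=m..m + m div 2. (bspline1 K 2 (design_point n i))\<^sup>2)"
  proof (rule sum_mono)
    fix i assume i: "i \<in> {m..m + m div 2}"
    then have "real i / real m \<ge> 1" using m by simp
    moreover have "real i \<le> 3 / 2 * real m" using i by simp linarith
    then have "real i / real m \<le> 3 / 2" using m by (simp add: field_simps)
    ultimately have "1 / 2 \<le> 1 - \<bar>real i / real m - (real 2 - 1)\<bar>"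
      unfolding abs_if by auto
    then have "bspline1 K 2 (design_point n i) \<ge> 1 / 2"
      unfolding bspline1_design_eq[OF assms(1,2)] by (rule max.coboundedI2)
    from power_mono[OF this, of 2]
    show "1 / 4 \<le> (bspline1 K 2 (design_point n i))\<^sup>2" by (simp add: power2_eq_square)
  qed
  also have "\<dots> \<le> beta n K" unfolding beta_def
    using sub by (intro sum_mono2) auto
  finally show ?thesis .
qed

text \<open>The spline is at most 1 and vanishes unless i is closer than \<open>m\<close> to (k - 1)
  m, which leaves fewer than 2 m indices.\<close>

lemma sum_bspline1_sq_le:
  assumes "n \<ge> 1" "n = K * m" "k \<ge> 1"
  shows "(\<Sum>i=1..n. (bspline1 K k (design_point n i))\<^sup>2) \<le> 2 * real m"
proof -
  have m: "m \<ge> 1" using assms by (cases m) auto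
  define a where "a = (k - 1) * m"
  have a: "real a = (real k - 1) * real m" using assms(3) by (simp add: a_def of_nat_diff)
  \<comment> \<open>Both conditions use addition because a - m would be truncated for k = 1, where a
    = 0.\<close>
  define I where "I = {i. a < i + m \<and> i < a + m}"
  have I: "I = {Suc a - m..<a + m}" unfolding I_def by auto
  have zero: "(bspline1 K k (design_point n i))\<^sup>2 = 0" if "i \<notin> I" for i
  proof -
    have "real i + real m \<le> real a \<or> real i \<ge> real a + real m" using that unfolding I_def by auto
    then have "real i / real m \<le> real k - 1 - 1 \<or> real i / real m \<ge> real k - 1 + 1"
      using m unfolding a by (auto simp: field_simps)
    then show ?thesis unfolding bspline1_design_eq[OF assms(1,2)] by auto
  qed
  have "(\<Sum>i=1..n. (bspline1 K k (design_point n i))\<^sup>2)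
      = (\<Sum>i\<in>{1..n} \<inter> I. (bspline1 K k (design_point n i))\<^sup>2)"
    using zero by (intro sum.mono_neutral_right) auto
  also have "\<dots> \<le> (\<Sum>i\<in>{1..n} \<inter> I. 1)"
    by (intro sum_mono) (simp add: bspline1_nonneg bspline1_le_1 power_le_one)
  also have "\<dots> = real (card ({1..n} \<inter> I))" by simp
  also have "\<dots> \<le> real (card I)" unfolding I by (intro of_nat_mono card_mono) auto
  also have "\<dots> \<le> 2 * real m" unfolding I by simp
  finally show ?thesis .
qed

section \<open>Existence of the constrained minimizer\<close>

text \<open>The direct method without a norm: coercivity puts the sublevel set of \<open>g0\<close>
  into a product of compact sets. A minimizer over that box is at most \<open>J g0\<close>, hence
  also beats every point outside the sublevel set.\<close>

lemma coercive_attains_inf: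
  fixes J :: "('i \<Rightarrow> real) \<Rightarrow> real"
  assumes "continuous_on UNIV J" "closed S" "\<And>i. compact (C i)" "g0 \<in> S"
    and coercive: "\<And>g i. g \<in> S \<Longrightarrow> J g \<le> J g0 \<Longrightarrow> g i \<in> C i"
  shows "\<exists>g\<in>S. \<forall>h\<in>S. J g \<le> J h"
proof -
  have "compact (PiE UNIV C \<inter> S)"
    using assms by (intro compact_Int_closed compact_PiE_UNIV)
  moreover have g0: "g0 \<in> PiE UNIV C \<inter> S" using assms by auto
  moreover have "continuous_on (PiE UNIV C \<inter> S) J"
    using assms(1) continuous_on_subset by blast
  ultimately obtain g where g: "g \<in> PiE UNIV C \<inter> S" "\<And>h. h \<in> PiE UNIV C \<inter> S \<Longrightarrow> J g \<le> J h"
    using continuous_attains_inf[of "PiE UNIV C \<inter> S" J] by (metis empty_iff)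
  have "J g \<le> J h" if "h \<in> S" for h
  proof (cases "J h \<le> J g0")
    case True
    then show ?thesis using g(2)[of h] coercive[OF that] that by auto
  next
    case False
    then show ?thesis using g(2)[OF g0] by simp
  qed
  then show ?thesis using g(1) by auto
qed

text \<open>Both summands of \<open>Lambda_mat\<close> are scaled Gram matrices, so moving the
  transpose across the scalar product leaves squared lengths. Data term and penalty can then be
  bounded separately.\<close>

lemma quadratic_form_Lambda:
  assumes b: "b \<in> carrier_vec (K + 1)"
  shows "b \<bullet> (Lambda_mat n K lam *\<^sub>v b)
    = 1 / beta n K * ((design_matrix n K *\<^sub>v b) \<bullet> (design_matrix n K *\<^sub>v b))
      + lam * ((second_diff K *\<^sub>v b) \<bullet> (second_diff K *\<^sub>v b))"
proof -
  have X: "design_matrix n K \<in> carrier_mat n (K + 1)" by (simp add: design_matrix_def)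
  have D: "second_diff K \<in> carrier_mat (K - 1) (K + 1)" by (simp add: second_diff_def)
  have gram: "b \<bullet> ((a \<cdot>\<^sub>m (transpose_mat A * A)) *\<^sub>v b) = a * ((A *\<^sub>v b) \<bullet> (A *\<^sub>v b))"
    if A: "A \<in> carrier_mat p (K + 1)" for a A p
  proof -
    have "(a \<cdot>\<^sub>m (transpose_mat A * A)) *\<^sub>v b = a \<cdot>\<^sub>v (transpose_mat A *\<^sub>v (A *\<^sub>v b))"
    proof -
      have "transpose_mat A * A *\<^sub>v b = transpose_mat A *\<^sub>v (A *\<^sub>v b)"
        using A b by (intro assoc_mult_mat_vec) auto
      moreover have "(a \<cdot>\<^sub>m B) *\<^sub>v b = a \<cdot>\<^sub>v (B *\<^sub>v b)" if "B \<in> carrier_mat (K + 1) (K + 1)" for B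
        using that b by (intro eq_vecI) (auto simp: scalar_prod_def sum_distrib_left ac_simps simp del: sum.op_ivl_Suc)
      ultimately show ?thesis using A by simp
    qed
    moreover have "(A *\<^sub>v b) \<bullet> (A *\<^sub>v b) = b \<bullet> (transpose_mat A *\<^sub>v (A *\<^sub>v b))"
      using transpose_vec_mult_scalar[OF A b, of "A *\<^sub>v b"] A b
        comm_scalar_prod[of b "K + 1" "transpose_mat A *\<^sub>v (A *\<^sub>v b)"] by auto
    ultimately show ?thesis using A b by simp
  qed
  have carrier: "(a \<cdot>\<^sub>m (transpose_mat A * A)) *\<^sub>v b \<in> carrier_vec (K + 1)"
    if "A \<in> carrier_mat p (K + 1)" for a A p
    using that by (intro mult_mat_vec_carrier[OF _ b]) auto
  have eq: "Lambda_mat n K lam *\<^sub>v b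
      = (1 / beta n K) \<cdot>\<^sub>m (transpose_mat (design_matrix n K) * design_matrix n K) *\<^sub>v b
        + (lam \<cdot>\<^sub>m (transpose_mat (second_diff K) * second_diff K)) *\<^sub>v b"
    unfolding Lambda_mat_def Gamma_mat_def
    using X D b by (intro add_mult_distrib_mat_vec[where nr = "K + 1" and nc = "K + 1"]) auto
  show ?thesis
    unfolding eq
    by (subst scalar_prod_add_distrib[OF b carrier[OF X] carrier[OF D]], subst gram[OF X], subst gram[OF D], rule refl)
qed

lemma scalar_prod_self: "v \<bullet> v = (\<Sum>i<dim_vec v. (v $ i)\<^sup>2)" for v :: "real vec"
  by (simp add: scalar_prod_def power2_eq_square atLeast0LessThan)

text \<open>Design point \<open>j * m\<close> is the knot j / K, where all splines but the one at
  position \<open>j\<close> vanish. \<open>j\<close> starts at 1 because 0 is not a design point;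
  row \<open>j * m - 1\<close> belongs to design point \<open>j * m\<close>.\<close>

lemma design_matrix_at_knot:
  assumes "n \<ge> 1" "n = K * m" "b \<in> carrier_vec (K + 1)" "j \<in> {1..K}"
  shows "(design_matrix n K *\<^sub>v b) $ (j * m - 1) = b $ j"
proof -
  have m: "m \<ge> 1" and K: "K \<ge> 1" using assms(1,2) by (cases m; cases K; auto)+
  have jm: "1 \<le> j * m" "j * m \<le> n" using assms m by auto
  have pt: "design_point n (j * m) = real j / real K"
    using m by (simp add: design_point_def assms(2))
  define p where "p = j * m - 1"
  have p: "p < n" "Suc p = j * m" using jm unfolding p_def by linarith+
  have "(design_matrix n K *\<^sub>v b) $ p = (\<Sum>i<K + 1. bspline1 K (i + 1) (design_point n (Suc p)) * b $ i)"
    using p(1) assms(3)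
    by (simp add: design_matrix_def scalar_prod_def atLeast0LessThan del: sum.lessThan_Suc)
  also have "\<dots> = (\<Sum>i<K + 1. if i = j then b $ i else 0)"
    using K by (intro sum.cong) (auto simp: p(2) pt bspline1_knot)
  also have "\<dots> = b $ j" using assms(4) by simp
  finally show ?thesis unfolding p_def .
qed

text \<open>The rows at the knots 1 / K, ..., 1 show that the data term controls all coefficients
  except the one at knot 0. For n = K the first spline even vanishes at every design point, so b_0
  is recovered from b_1, b_2 and the first second difference, which the penalty controls for
  \<open>lam > 0\<close>.\<close>

lemma Lambda_coercive:
  assumes "n \<ge> 1" "K dvd n" "K \<ge> 2" "lam > 0"
  shows "\<exists>c>0. \<forall>b\<in>carrier_vec (K + 1). c * (\<Sum>i<K + 1. (b $ i)\<^sup>2) \<le> b \<bullet> (Lambda_mat n K lam *\<^sub>v b)"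
proof -
  obtain m where n: "n = K * m" using assms(2) by auto
  have m: "m \<ge> 1" using assms(1) n by (cases m) auto
  have beta: "beta n K > 0" using beta_ge[OF assms(1) n assms(3)] m by linarith
  \<comment> \<open>The factors 16 and 3 match the bound 16 S + 3 d^2 on the squared length: from
    b_0 = d + 2 b_1 - b_2 one gets b_0^2 \<le> 3 d^2 + 12 b_1^2 + 3 b_2^2 \<le> 3 d^2 + 15
    S.\<close>
  define c where "c = min (1 / (16 * beta n K)) (lam / 3)"
  have c: "c > 0" "16 * c \<le> 1 / beta n K" "3 * c \<le> lam"
    using beta assms(4) by (auto simp: c_def min_def field_simps)
  have "c * (\<Sum>i<K + 1. (b $ i)\<^sup>2) \<le> b \<bullet> (Lambda_mat n K lam *\<^sub>v b)" if b: "b \<in> carrier_vec (K + 1)" for b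
  proof -
    define S where "S = (\<Sum>j=1..K. (b $ j)\<^sup>2)"
    define d where "d = b $ 0 - 2 * b $ 1 + b $ 2"
    have S1: "(b $ 1)\<^sup>2 \<le> S" "(b $ 2)\<^sup>2 \<le> S"
      unfolding S_def using assms(3) by (auto intro!: member_le_sum)
    have "S \<ge> 0" unfolding S_def by (intro sum_nonneg) auto
    have inj: "inj_on (\<lambda>j. j * m - 1) {1..K}"
    proof (rule inj_onI)
      fix i j assume "i \<in> {1..K}" "j \<in> {1..K}" "i * m - 1 = j * m - 1"
      moreover from this have "i * m \<ge> 1" "j * m \<ge> 1" using m by auto
      ultimately have "i * m = j * m" by linarith
      then show "i = j" using m by simp
    qed
    have "S = (\<Sum>j=1..K. ((design_matrix n K *\<^sub>v b) $ (j * m - 1))\<^sup>2)"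
      unfolding S_def by (intro sum.cong refl, subst design_matrix_at_knot[OF assms(1) n b]) auto
    also have "\<dots> = (\<Sum>i\<in>(\<lambda>j. j * m - 1) ` {1..K}. ((design_matrix n K *\<^sub>v b) $ i)\<^sup>2)"
      by (rule sum.reindex_cong[OF inj, symmetric]) auto
    also have "\<dots> \<le> (design_matrix n K *\<^sub>v b) \<bullet> (design_matrix n K *\<^sub>v b)"
      unfolding scalar_prod_self
    proof (intro sum_mono2)
      have "j * m - 1 < n" if "j \<in> {1..K}" for j
      proof -
        have "j * m \<le> n" using that n by simp
        then show ?thesis using assms(1) by linarith
      qed
      then show "(\<lambda>j. j * m - 1) ` {1..K} \<subseteq> {..<dim_vec (design_matrix n K *\<^sub>v b)}"
        by (auto simp: design_matrix_def)
    qed auto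
    finally have X: "S \<le> (design_matrix n K *\<^sub>v b) \<bullet> (design_matrix n K *\<^sub>v b)" .
    have "(second_diff K *\<^sub>v b) $ 0
        = (\<Sum>j<K + 1. if j \<in> {0, 1, 2} then (if j = 0 then 1 else if j = 1 then - 2 else 1) * b $ j else 0)"
      using assms(3) b unfolding second_diff_def
      by (simp add: scalar_prod_def atLeast0LessThan del: sum.lessThan_Suc) (intro sum.cong, auto)
    also have "\<dots> = (\<Sum>j\<in>{0, 1, 2}. (if j = 0 then 1 else if j = 1 then - 2 else 1) * b $ j)"
      using assms(3) by (subst sum.inter_restrict[symmetric]) (auto intro!: sum.cong)
    also have "\<dots> = d" by (simp add: d_def)
    finally have "d\<^sup>2 = ((second_diff K *\<^sub>v b) $ 0)\<^sup>2" by simp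
    also have "\<dots> \<le> (second_diff K *\<^sub>v b) \<bullet> (second_diff K *\<^sub>v b)"
      unfolding scalar_prod_self using assms(3) by (intro member_le_sum) (auto simp: second_diff_def)
    finally have D: "d\<^sup>2 \<le> (second_diff K *\<^sub>v b) \<bullet> (second_diff K *\<^sub>v b)" .
    have "(b $ 0)\<^sup>2 \<le> 3 * d\<^sup>2 + 12 * (b $ 1)\<^sup>2 + 3 * (b $ 2)\<^sup>2"
    proof -
      \<comment> \<open>The right side exceeds the left by (x - y)^2 + (y - z)^2 + (x -
        z)^2.\<close>
      have "(x + y + z)\<^sup>2 \<le> 3 * (x\<^sup>2 + y\<^sup>2 + z\<^sup>2)" for x y z :: real
        using sum_squares_ge_zero[of "x - y" "y - z"] zero_le_power2[of "x - z"]
        by (simp add: power2_eq_square algebra_simps)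
      from this[of d "2 * b $ 1" "- b $ 2"] show ?thesis by (simp add: d_def power_mult_distrib)
    qed
    moreover have "(\<Sum>i<K + 1. (b $ i)\<^sup>2) = (b $ 0)\<^sup>2 + S"
    proof -
      have "{..<K + 1} = insert 0 {1..K}" by auto
      then show ?thesis unfolding S_def by simp
    qed
    ultimately have "(\<Sum>i<K + 1. (b $ i)\<^sup>2) \<le> 16 * S + 3 * d\<^sup>2" using S1 by linarith
    then have "c * (\<Sum>i<K + 1. (b $ i)\<^sup>2) \<le> c * (16 * S + 3 * d\<^sup>2)" using c(1) by (intro mult_left_mono) auto
    also have "\<dots> = (16 * c) * S + (3 * c) * d\<^sup>2" by (simp add: algebra_simps)
    also have "\<dots> \<le> b \<bullet> (Lambda_mat n K lam *\<^sub>v b)"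
      unfolding quadratic_form_Lambda[OF b]
      using c X D \<open>S \<ge> 0\<close> assms(4) beta by (intro add_mono mult_mono) auto
    finally show ?thesis .
  qed
  then show ?thesis using c(1) by blast
qed

text \<open>Without an existing minimizer, \<open>b_hat\<close> would be an arbitrary vector of unknown dimension, and
  \<open>vec_sup_norm\<close> would not control its entries. Minimizers are sought among coefficient functions
  \<open>nat \<Rightarrow> real\<close>, where the product topology is available.\<close>
lemma b_hat_in_Omega:
  assumes "n \<ge> 1" "K dvd n" "K \<ge> 2" "lam > 0" and y: "y \<in> carrier_vec (K + 1)"
  shows "b_hat n K lam y \<in> Omega K"
proof -
  define F where "F = (\<lambda>b. 1 / 2 * (b \<bullet> (Lambda_mat n K lam *\<^sub>v b)) - b \<bullet> y)"
  obtain c where c: "c > 0"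
    "\<forall>b\<in>carrier_vec (K + 1). c * (\<Sum>i<K + 1. (b $ i)\<^sup>2) \<le> b \<bullet> (Lambda_mat n K lam *\<^sub>v b)"
    using Lambda_coercive[OF assms(1-4)] by blast
  \<comment> \<open>For \<open>F b \<le> 0\<close>, absorbing the linear term leaves (c / 4) b_i^2
    \<le> (sum of y_i^2) / c; \<open>R\<close> is the resulting bound on the entries.\<close>
  define R where "R = sqrt (\<Sum>i<K + 1. 4 * (y $ i)\<^sup>2 / c\<^sup>2)"
  \<comment> \<open>Setting the entries beyond K to 0 makes them trivially compact in the box
    argument.\<close>
  define S where "S = {g :: nat \<Rightarrow> real. (\<forall>i. i \<ge> K + 1 \<longrightarrow> g i = 0) \<and> vec (K + 1) g \<in> Omega K}"
  have dims [simp]: "dim_row (Lambda_mat n K lam) = K + 1" "dim_col (Lambda_mat n K lam) = K + 1"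
    by (simp_all add: Lambda_mat_def Gamma_mat_def design_matrix_def second_diff_def)
  have coord: "continuous_on UNIV (\<lambda>g. g i)" for i :: nat
    by simp
  have cont: "continuous_on UNIV (\<lambda>g. F (vec (K + 1) g))"
    unfolding F_def using y
    by (simp add: scalar_prod_def mult_mat_vec_def) (intro continuous_intros coord, auto)
  have Omega: "vec (K + 1) g \<in> Omega K \<longleftrightarrow> (\<forall>i<K - 1. (\<Sum>j<K + 1. second_diff K $$ (i, j) * g j) \<ge> 0)" for g
    by (simp add: Omega_def less_eq_vec_def scalar_prod_def second_diff_def atLeast0LessThan del: sum.lessThan_Suc)
  have closed: "closed S"
    unfolding S_def Omega imp_conv_disj
    by (intro closed_Collect_conj closed_Collect_all closed_Collect_disj closed_Collect_eq closed_Collect_le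
        continuous_intros coord) auto
  have bound: "\<bar>b $ i\<bar> \<le> R" if b: "b \<in> carrier_vec (K + 1)" and le: "F b \<le> 0" and i: "i < K + 1" for b i
  proof -
    \<comment> \<open>Half of the coercive term c / 2 * s^2 absorbs the linear term by completing a
      square; the other half remains.\<close>
    have young: "c / 4 * s\<^sup>2 \<le> c / 2 * s\<^sup>2 - s * t + t\<^sup>2 / c" for s t :: real
    proof -
      have "0 \<le> (c * s / 2 - t)\<^sup>2 / c" using c(1) by simp
      also have "\<dots> = c / 4 * s\<^sup>2 - s * t + t\<^sup>2 / c"
        using c(1) by (simp add: power2_eq_square field_simps)
      finally show ?thesis by linarith
    qed
    have "c / 4 * (b $ i)\<^sup>2 \<le> (\<Sum>i<K + 1. c / 4 * (b $ i)\<^sup>2)"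
      using i c(1) by (intro member_le_sum) auto
    also have "\<dots> \<le> (\<Sum>i<K + 1. c / 2 * (b $ i)\<^sup>2 - b $ i * y $ i + (y $ i)\<^sup>2 / c)"
      by (intro sum_mono young)
    also have "\<dots> = 1 / 2 * (c * (\<Sum>i<K + 1. (b $ i)\<^sup>2)) - b \<bullet> y + (\<Sum>i<K + 1. (y $ i)\<^sup>2 / c)"
      using b y by (simp add: sum.distrib sum_subtractf scalar_prod_def atLeast0LessThan sum_distrib_left
          del: sum.lessThan_Suc)
    also have "\<dots> \<le> F b + (\<Sum>i<K + 1. (y $ i)\<^sup>2 / c)"
      unfolding F_def using bspec[OF c(2) b] by simp
    also have "\<dots> \<le> (\<Sum>i<K + 1. (y $ i)\<^sup>2 / c)" using le by simp
    finally have "c / 4 * (b $ i)\<^sup>2 \<le> (\<Sum>i<K + 1. (y $ i)\<^sup>2 / c)" .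
    then have "4 / c * (c / 4 * (b $ i)\<^sup>2) \<le> 4 / c * (\<Sum>i<K + 1. (y $ i)\<^sup>2 / c)"
      using c(1) by (intro mult_left_mono) auto
    also have "\<dots> = (\<Sum>i<K + 1. 4 * (y $ i)\<^sup>2 / c\<^sup>2)"
      unfolding sum_distrib_left by (intro sum.cong) (simp_all add: power2_eq_square)
    finally have "(b $ i)\<^sup>2 \<le> (\<Sum>i<K + 1. 4 * (y $ i)\<^sup>2 / c\<^sup>2)" using c(1) by simp
    then show ?thesis unfolding R_def using real_sqrt_le_mono by fastforce
  qed
  have F0: "F (vec (K + 1) (\<lambda>_. 0)) = 0"
    using y by (simp add: F_def scalar_prod_def)
  have "\<exists>g\<in>S. \<forall>h\<in>S. F (vec (K + 1) g) \<le> F (vec (K + 1) h)"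
  proof (rule coercive_attains_inf[OF cont closed, where C = "\<lambda>i. if i < K + 1 then {-R..R} else {0}"
        and ?g0.0 = "\<lambda>_. 0"])
    show "(\<lambda>_. 0) \<in> S" unfolding S_def mem_Collect_eq Omega by simp
    show "g i \<in> (if i < K + 1 then {-R..R} else {0})"
      if "g \<in> S" "F (vec (K + 1) g) \<le> F (vec (K + 1) (\<lambda>_. 0))" for g i
    proof (cases "i < K + 1")
      case True
      then have "\<bar>vec (K + 1) g $ i\<bar> \<le> R"
        using that(2) unfolding F0 by (intro bound) auto
      then have "\<bar>g i\<bar> \<le> R" unfolding index_vec[OF True] .
      then show ?thesis using True by auto
    next
      case False
      then show ?thesis using that(1) by (simp add: S_def)
    qed
  qed auto
  then obtain g where g: "g \<in> S" "\<forall>h\<in>S. F (vec (K + 1) g) \<le> F (vec (K + 1) h)" by blast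
  have "F (vec (K + 1) g) \<le> F b" if b: "b \<in> Omega K" for b
  proof -
    have eq: "vec (K + 1) (\<lambda>i. if i < K + 1 then b $ i else 0) = b"
      using b by (intro eq_vecI) (auto simp: Omega_def)
    have "(\<lambda>i. if i < K + 1 then b $ i else 0) \<in> S"
      unfolding S_def mem_Collect_eq eq using b by simp
    from bspec[OF g(2) this] show ?thesis unfolding eq .
  qed
  then have "is_arg_min F (\<lambda>b. b \<in> Omega K) (vec (K + 1) g)"
    using g(1) by (auto simp: is_arg_min_linorder S_def)
  \<comment> \<open>Some minimizer exists, so the one chosen by \<open>arg_min_on\<close> is a
    minimizer too.\<close>
  then have "is_arg_min F (\<lambda>b. b \<in> Omega K) (b_hat n K lam y)"
    unfolding b_hat_def arg_min_on_def arg_min_def F_def by (rule someI)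
  then show ?thesis by (simp add: is_arg_min_def)
qed

section \<open>Measurability of the fitted coefficients\<close>

text \<open>The bound involves finitely many coordinates, each continuous in the product topology,
  and tends to 0 as g tends to h. Squeezing gives continuity, hence Borel measurability.\<close>

lemma lipschitz_coordinates_measurable:
  fixes F :: "(nat \<Rightarrow> real) \<Rightarrow> real"
  assumes "\<And>g h. \<bar>F g - F h\<bar> \<le> C * (\<Sum>j<d. \<bar>g j - h j\<bar>)"
  shows "F \<in> borel_measurable borel"
proof (rule borel_measurable_continuous_onI)
  have "isCont F h" for h
    unfolding isCont_def
  proof (rule LIM_zero_cancel)
    have "isCont (\<lambda>g. C * (\<Sum>j<d. \<bar>g j - h j\<bar>)) h"
      by (rule continuous_on_interior[of UNIV]) (intro continuous_intros continuous_on_product_coordinates, simp)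
    then have "(\<lambda>g. C * (\<Sum>j<d. \<bar>g j - h j\<bar>)) \<midarrow>h\<rightarrow> 0" by (simp add: isCont_def)
    then show "(\<lambda>g. F g - F h) \<midarrow>h\<rightarrow> 0"
      by (rule Lim_null_comparison[rotated]) (use assms in auto)
  qed
  then show "continuous_on UNIV F" by (simp add: continuous_on_eq_continuous_at)
qed

lemma vec_sup_norm_le_sum:
  assumes "dim_vec v > 0"
  shows "vec_sup_norm v \<le> (\<Sum>j<dim_vec v. \<bar>v $ j\<bar>)"
  unfolding vec_sup_norm_def using assms
  by (subst Max_le_iff) (auto intro!: member_le_sum)

lemma uniform_lipschitzD:
  assumes "uniform_lipschitz lambar P \<kappa>" "n \<ge> 1" "K \<ge> 2" "K dvd n" "n div K \<ge> P" "0 \<le> lam" "lam \<le> lambar"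
    and "y1 \<in> carrier_vec (K + 1)" "y2 \<in> carrier_vec (K + 1)"
  shows "vec_sup_norm (b_hat n K lam y1 - b_hat n K lam y2) \<le> \<kappa> * vec_sup_norm (y1 - y2)"
  using assms unfolding uniform_lipschitz_def by auto

lemma b_hat_measurable:
  assumes lip: "uniform_lipschitz lambar P \<kappa>" "\<kappa> > 0"
    and n: "n \<ge> 1" "K \<ge> 2" "K dvd n" "n div K \<ge> P" and lam: "0 < lam" "lam \<le> lambar"
    and h: "\<And>j. (\<lambda>\<omega>. h \<omega> j) \<in> borel_measurable M" and k: "k < K + 1"
  shows "(\<lambda>\<omega>. b_hat n K lam (vec (K + 1) (h \<omega>)) $ k) \<in> borel_measurable M"
proof -
  have "(\<lambda>g. b_hat n K lam (vec (K + 1) g) $ k) \<in> borel_measurable borel"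
  proof (rule lipschitz_coordinates_measurable)
    fix g g' :: "nat \<Rightarrow> real"
    let ?b = "\<lambda>g. b_hat n K lam (vec (K + 1) g)"
    \<comment> \<open>Feasibility fixes the length, so entry \<open>k\<close> is among those over
      which \<open>vec_sup_norm\<close> takes the maximum.\<close>
    have dim: "dim_vec (?b g) = Suc K" for g
      using b_hat_in_Omega[OF n(1,3,2) lam(1), of "vec (K + 1) g"] by (auto simp: Omega_def)
    have "\<bar>?b g $ k - ?b g' $ k\<bar> \<le> vec_sup_norm (?b g - ?b g')"
      unfolding vec_sup_norm_def using k by (intro Max_ge) (auto simp: dim[simplified])
    also have "\<dots> \<le> \<kappa> * vec_sup_norm (vec (K + 1) g - vec (K + 1) g')"
      using lam by (intro uniform_lipschitzD[OF lip(1) n]) auto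
    also have "\<dots> \<le> \<kappa> * (\<Sum>j<K + 1. \<bar>g j - g' j\<bar>)"
      using vec_sup_norm_le_sum[of "vec (K + 1) g - vec (K + 1) g'"] lip(2)
      by (intro mult_left_mono) auto
    finally show "\<bar>?b g $ k - ?b g' $ k\<bar> \<le> \<kappa> * (\<Sum>j<K + 1. \<bar>g j - g' j\<bar>)" .
  qed
  moreover have "h \<in> borel_measurable M"
    by (rule measurable_coordinatewise_then_product) (rule h)
  ultimately show ?thesis by (rule measurable_compose[rotated])
qed

section \<open>Reduction of the spline error to weighted noise\<close>

text \<open>This is X^T u / beta_n, kept as a function on naturals so that linearity and
  measurability concern plain sums. \<open>u\<close> is indexed from 1 and the result from
  0.\<close>

definition weighted_data :: "nat \<Rightarrow> nat \<Rightarrow> (nat \<Rightarrow> real) \<Rightarrow> nat \<Rightarrow> real" where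
  "weighted_data n K u j = (\<Sum>i=1..n. bspline1 K (j + 1) (design_point n i) / beta n K * u i)"

lemma weighted_data_add:
  "weighted_data n K (\<lambda>i. u i + v i) j = weighted_data n K u j + weighted_data n K v j"
  by (simp add: weighted_data_def sum.distrib distrib_left)

lemma transpose_design_eq_weighted_data:
  "(1 / beta n K) \<cdot>\<^sub>v (transpose_mat (design_matrix n K) *\<^sub>v vec n (\<lambda>i. u (i + 1)))
    = vec (K + 1) (weighted_data n K u)"
proof (intro eq_vecI)
  fix j assume "j < dim_vec (vec (K + 1) (weighted_data n K u))"
  then have j: "j < K + 1" by simp
  have "((1 / beta n K) \<cdot>\<^sub>v (transpose_mat (design_matrix n K) *\<^sub>v vec n (\<lambda>i. u (i + 1)))) $ j
      = 1 / beta n K * (\<Sum>i<n. bspline1 K (j + 1) (design_point n (i + 1)) * u (i + 1))"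
    using j by (simp add: design_matrix_def scalar_prod_def atLeast0LessThan)
  also have "\<dots> = weighted_data n K u j"
    unfolding weighted_data_def sum_distrib_left
    by (simp add: sum.atLeast1_atMost_eq ac_simps)
  finally show "((1 / beta n K) \<cdot>\<^sub>v (transpose_mat (design_matrix n K) *\<^sub>v vec n (\<lambda>i. u (i + 1)))) $ j
      = vec (K + 1) (weighted_data n K u) $ j" using j by simp
qed (simp add: design_matrix_def)

text \<open>The difference is again a linear spline, with the differences of the coefficients. Its
  sup norm equals \<open>vec_sup_norm\<close> because \<open>b_hat_in_Omega\<close> gives both
  vectors length K + 1.\<close>

lemma sup_norm_pspline_diff:
  fixes u v :: "nat \<Rightarrow> real"
  assumes "n \<ge> 1" "K dvd n" "K \<ge> 2" "lam > 0"
  shows "sup_norm (\<lambda>x. pspline n K lam (vec n (\<lambda>i. u (i + 1))) x - pspline n K lam (vec n (\<lambda>i. v (i + 1))) x)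
    = vec_sup_norm (b_hat n K lam (vec (K + 1) (weighted_data n K u))
                    - b_hat n K lam (vec (K + 1) (weighted_data n K v)))"
proof -
  let ?b = "\<lambda>u. b_hat n K lam (vec (K + 1) (weighted_data n K u))"
  have dim: "dim_vec (?b u) = Suc K" for u
    using b_hat_in_Omega[OF assms, of "vec (K + 1) (weighted_data n K u)"] by (auto simp: Omega_def)
  have "pspline n K lam (vec n (\<lambda>i. u (i + 1))) x - pspline n K lam (vec n (\<lambda>i. v (i + 1))) x
      = (\<Sum>k=1..K + 1. (?b u $ (k - 1) - ?b v $ (k - 1)) * bspline1 K k x)" for x
    unfolding pspline_def transpose_design_eq_weighted_data
    by (simp only: sum_subtractf[symmetric] left_diff_distrib)
  then have "sup_norm (\<lambda>x. pspline n K lam (vec n (\<lambda>i. u (i + 1))) x - pspline n K lam (vec n (\<lambda>i. v (i + 1))) x)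
      = Max ((\<lambda>k. \<bar>?b u $ k - ?b v $ k\<bar>) ` {..<K + 1})"
    using sup_norm_spline[of K "\<lambda>k. ?b u $ k - ?b v $ k"] assms(3) by simp
  also have "\<dots> = vec_sup_norm (?b u - ?b v)"
    unfolding vec_sup_norm_def by (intro arg_cong[where f = Max] image_cong) (auto simp: dim[simplified])
  finally show ?thesis .
qed

lemma (in prob_space) expectation_Max_weighted_noise:
  assumes n: "n \<ge> 1" "n = K * m" "K \<ge> 2" and \<sigma>: "\<sigma> > 0"
    and indep: "indep_vars (\<lambda>_. borel) e {1..n}"
    and normal: "\<And>i. i \<in> {1..n} \<Longrightarrow> distributed M lborel (e i) (\<lambda>x. ennreal (std_normal_density x))"
  shows "(\<integral>\<^sup>+\<omega>. ennreal (Max ((\<lambda>j. \<bar>weighted_data n K (\<lambda>i. \<sigma> * e i \<omega>) j\<bar>) ` {..<K + 1})) \<partial>M)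
    \<le> ennreal (48 * \<sigma> * sqrt (real K * ln (real n) / real n))"
proof -
  have m: "m \<ge> 1" using n by (cases m) auto
  have n2: "n \<ge> 2" using n m by (metis mult_le_mono nat_mult_1_right)
  have ln: "ln (real n) > 0" using n2 by simp
  have beta: "beta n K \<ge> real m / 8" "beta n K > 0" using beta_ge[OF n] m by linarith+
  \<comment> \<open>\<open>s\<close> bounds the standard deviations: the variance is at most (8
    \<sigma> / m)^2 * 2 m = 128 \<sigma>^2 / m, rounded up to the square 144 \<sigma>^2 / m.\<close>
  define s where "s = 12 * \<sigma> / sqrt (real m)"
  have s: "s > 0" using m \<sigma> by (simp add: s_def)
  \<comment> \<open>This \<open>t\<close> balances the two terms of
    \<open>expectation_Max_subgaussian\<close>: ln n / t and t s^2 both become s * sqrt (ln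
    n).\<close>
  define t where "t = sqrt (ln (real n)) / s"
  have t: "t > 0" using ln s by (simp add: t_def)
  define a where "a j i = \<sigma> * (bspline1 K (j + 1) (design_point n i) / beta n K)" for j i
  have wd: "weighted_data n K (\<lambda>i. \<sigma> * e i \<omega>) j = (\<Sum>i=1..n. a j i * e i \<omega>)" for j \<omega>
    by (simp add: weighted_data_def a_def ac_simps)
  have [measurable]: "e i \<in> borel_measurable M" if "i \<in> {1..n}" for i
    using indep that by (auto simp: indep_vars_def2)
  have var: "(\<Sum>i=1..n. (a j i)\<^sup>2) \<le> s\<^sup>2" for j
  proof -
    have "(\<Sum>i=1..n. (a j i)\<^sup>2) = (\<sigma> / beta n K)\<^sup>2 * (\<Sum>i=1..n. (bspline1 K (j + 1) (design_point n i))\<^sup>2)"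
      unfolding a_def sum_distrib_left by (intro sum.cong) (simp_all add: power_mult_distrib power_divide)
    also have "\<dots> \<le> (\<sigma> / (real m / 8))\<^sup>2 * (2 * real m)"
      using beta m \<sigma> sum_bspline1_sq_le[OF n(1,2), of "j + 1"]
      by (intro mult_mono power_mono divide_left_mono) (auto intro: sum_nonneg)
    also have "\<dots> = 128 * \<sigma>\<^sup>2 / real m" using m by (simp add: power2_eq_square field_simps)
    also have "\<dots> \<le> 144 * \<sigma>\<^sup>2 / real m" by (intro divide_right_mono mult_right_mono) auto
    also have "\<dots> = s\<^sup>2" by (simp add: s_def power_divide power_mult_distrib)
    finally show ?thesis .
  qed
  have "(\<integral>\<^sup>+\<omega>. ennreal (Max ((\<lambda>j. \<bar>\<Sum>i=1..n. a j i * e i \<omega>\<bar>) ` {..<K + 1})) \<partial>M)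
      \<le> ennreal (ln (2 * card {..<K + 1}) / t + t * s\<^sup>2 / 2)"
  proof (rule expectation_Max_subgaussian[OF _ _ t])
    fix j u assume u: "\<bar>u\<bar> = t"
    have "(\<integral>\<^sup>+\<omega>. ennreal (exp (u * (\<Sum>i=1..n. a j i * e i \<omega>))) \<partial>M)
        = (\<integral>\<^sup>+\<omega>. ennreal (exp (\<Sum>i=1..n. u * a j i * e i \<omega>)) \<partial>M)"
      by (simp add: sum_distrib_left mult.assoc)
    also have "\<dots> = ennreal (exp ((\<Sum>i=1..n. (u * a j i)\<^sup>2) / 2))"
      by (rule mgf_normal_combination[OF _ indep normal]) auto
    also have "(\<Sum>i=1..n. (u * a j i)\<^sup>2) = \<bar>u\<bar>\<^sup>2 * (\<Sum>i=1..n. (a j i)\<^sup>2)"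
      by (simp add: sum_distrib_left power_mult_distrib)
    also have "ennreal (exp (\<bar>u\<bar>\<^sup>2 * (\<Sum>i=1..n. (a j i)\<^sup>2) / 2)) \<le> ennreal (exp (t\<^sup>2 * s\<^sup>2 / 2))"
      unfolding u using var[of j] by (intro ennreal_leI) (simp add: mult_left_mono)
    finally show "(\<integral>\<^sup>+\<omega>. ennreal (exp (u * (\<Sum>i=1..n. a j i * e i \<omega>))) \<partial>M)
        \<le> ennreal (exp (t\<^sup>2 * s\<^sup>2 / 2))" .
  qed (use n in auto)
  also have "\<dots> \<le> ennreal (48 * \<sigma> * sqrt (real K * ln (real n) / real n))"
  proof (rule ennreal_leI)
    define l where "l = sqrt (ln (real n))"
    have l: "l > 0" "l\<^sup>2 = ln (real n)" using ln by (auto simp: l_def)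
    \<comment> \<open>The crude power 3 holds for every n \<ge> 2 and turns the logarithm of the
      number of variables into 3 ln n.\<close>
    have "2 * (K + 1) \<le> n ^ 3"
    proof -
      have "K \<le> n" using n(2) m by simp
      then have "2 * (K + 1) \<le> 4 * n" using n2 by simp
      also have "\<dots> \<le> n * n * n" using mult_le_mono[OF n2 n2] by (intro mult_right_mono) auto
      finally show ?thesis by (simp add: power3_eq_cube)
    qed
    then have "real (2 * card {..<K + 1}) \<le> real n ^ 3"
      unfolding of_nat_power[symmetric] of_nat_le_iff by simp
    then have "ln (2 * card {..<K + 1}) \<le> ln (real n ^ 3)" using n2 by (subst ln_le_cancel_iff) auto
    also have "\<dots> = 3 * l\<^sup>2" using n2 by (simp add: ln_realpow l)
    finally have "ln (2 * card {..<K + 1}) / t + t * s\<^sup>2 / 2 \<le> 3 * l\<^sup>2 / t + t * s\<^sup>2 / 2"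
      using t by (intro add_right_mono divide_right_mono) auto
    also have "\<dots> = 7 / 2 * (s * l)"
      unfolding t_def l_def[symmetric] using l s by (simp add: power2_eq_square field_simps)
    \<comment> \<open>Rounding 7 / 2 up to 4 gives 4 * 12 = 48.\<close>
    also have "\<dots> \<le> 4 * (s * l)" using s l by simp
    also have "\<dots> = 48 * \<sigma> * sqrt (ln (real n) / real m)"
      by (simp add: s_def l_def real_sqrt_divide)
    also have "ln (real n) / real m = real K * ln (real n) / real n"
      using n m by (simp add: field_simps)
    finally show "ln (2 * card {..<K + 1}) / t + t * s\<^sup>2 / 2 \<le> 48 * \<sigma> * sqrt (real K * ln (real n) / real n)" .
  qed
  finally show ?thesis unfolding wd .
qed

theorem proposition4p5:
  fixes r L \<sigma> lambar :: real
    and N :: "nat set" and K :: "nat \<Rightarrow> nat" and lam :: "nat \<Rightarrow> real"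
    and M :: "'a measure" and eps :: "nat \<Rightarrow> nat \<Rightarrow> 'a \<Rightarrow> real"
  assumes "1 < r" "r \<le> 2" "L > 0" "\<sigma> > 0" "lambar > 0"
    and lipschitz: "\<exists>P kappa. kappa > 0 \<and> uniform_lipschitz lambar P kappa"
    and N: "infinite N" "0 \<notin> N"
    and K: "\<And>n. n \<in> N \<Longrightarrow> K n \<ge> 2 \<and> K n dvd n"
    and lam: "\<And>n. n \<in> N \<Longrightarrow> 0 < lam n \<and> lam n \<le> lambar"
    and K_lim1: "filterlim (\<lambda>n. real n / real (K n)) at_top (inf sequentially (principal N))"
    and K_lim2: "((\<lambda>n. real (K n) / (real n powr (1 / (2 * r + 1)) * sqrt (ln (real n)))) \<longlongrightarrow> 0)
                   (inf sequentially (principal N))"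
    and M: "prob_space M"
    and eps_indep: "\<And>n. n \<in> N \<Longrightarrow> prob_space.indep_vars M (\<lambda>_. borel) (eps n) {1..n}"
    and eps_normal: "\<And>n i. n \<in> N \<Longrightarrow> i \<in> {1..n} \<Longrightarrow>
                       distributed M lborel (eps n i) (\<lambda>x. ennreal (std_normal_density x))"
  defines "err \<equiv> \<lambda>n f \<omega>. sup_norm (\<lambda>x.
             pspline n (K n) (lam n) (noisy_data n f \<sigma> (\<lambda>i. eps n i \<omega>)) x
               - pspline n (K n) (lam n) (exact_data n f) x)"
  shows "\<exists>C3>0. eventually (\<lambda>n.
           (\<forall>f\<in>holder_convex r L. err n f \<in> borel_measurable M) \<and>
           (SUP f\<in>holder_convex r L. \<integral>\<^sup>+\<omega>. ennreal (err n f \<omega>) \<partial>M)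
             \<le> ennreal (C3 * sqrt (real (K n) * ln (real n) / real n)))
         (inf sequentially (principal N))"
proof -
  interpret prob_space M by (rule M)
  obtain P \<kappa> where lip: "\<kappa> > 0" "uniform_lipschitz lambar P \<kappa>" using lipschitz by blast
  \<comment> \<open>The right side is free of \<open>f\<close>, so it bounds the supremum
    directly.\<close>
  have bound: "err n f \<in> borel_measurable M \<and> (\<integral>\<^sup>+\<omega>. ennreal (err n f \<omega>) \<partial>M)
      \<le> ennreal (\<kappa> * 48 * \<sigma> * sqrt (real (K n) * ln (real n) / real n))"
    if nN: "n \<in> N" and P: "real P \<le> real n / real (K n)" for n f
  proof -
    have n: "n \<ge> 1" "K n dvd n" "K n \<ge> 2" using N K[OF nN] nN by (auto simp: Suc_le_eq intro: gr0I)
    obtain m where m: "n = K n * m" using n(2) by blast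
    have "n div K n \<ge> P" using P unfolding real_of_nat_div[OF n(2), symmetric] by simp
    note lip_n = n(1,3,2) this
    have lam_n: "0 < lam n" "lam n \<le> lambar" using lam[OF nN] by auto
    have [measurable]: "eps n i \<in> borel_measurable M" if "i \<in> {1..n}" for i
      using eps_indep[OF nN] that by (auto simp: indep_vars_def2)
    let ?u = "\<lambda>i. f (design_point n i)"
    let ?w = "\<lambda>\<omega> i. \<sigma> * eps n i \<omega>"
    let ?b = "\<lambda>u. b_hat n (K n) (lam n) (vec (K n + 1) (weighted_data n (K n) u))"
    have err: "err n f \<omega> = vec_sup_norm (?b (\<lambda>i. ?u i + ?w \<omega> i) - ?b ?u)" for \<omega>
      unfolding err_def noisy_data_def exact_data_def
      using sup_norm_pspline_diff[OF n lam_n(1), of "\<lambda>i. ?u i + ?w \<omega> i" ?u] .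
    have dim: "dim_vec (?b u) = Suc (K n)" for u
      using b_hat_in_Omega[OF n lam_n(1), of "vec (K n + 1) (weighted_data n (K n) u)"]
      by (auto simp: Omega_def)
    \<comment> \<open>Only the noisy fit depends on \<omega>; the error is a maximum of finitely
      many of its coefficients minus constants, in absolute value.\<close>
    have "(\<lambda>\<omega>. ?b (\<lambda>i. ?u i + ?w \<omega> i) $ k) \<in> borel_measurable M" if "k < K n + 1" for k
      by (rule b_hat_measurable[OF lip(2,1) lip_n lam_n _ that]) (unfold weighted_data_def, measurable)
    then have "(\<lambda>\<omega>. Max ((\<lambda>k. \<bar>?b (\<lambda>i. ?u i + ?w \<omega> i) $ k - ?b ?u $ k\<bar>) ` {..<K n + 1})) \<in> borel_measurable M"
      by (intro borel_measurable_Max borel_measurable_abs borel_measurable_diff) auto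
    also have "(\<lambda>\<omega>. Max ((\<lambda>k. \<bar>?b (\<lambda>i. ?u i + ?w \<omega> i) $ k - ?b ?u $ k\<bar>) ` {..<K n + 1})) = err n f"
      unfolding err vec_sup_norm_def fun_eq_iff
      by (intro allI arg_cong[where f = Max] image_cong) (auto simp: dim[simplified])
    finally have meas: "err n f \<in> borel_measurable M" .
    let ?\<xi> = "\<lambda>\<omega>. Max ((\<lambda>j. \<bar>weighted_data n (K n) (?w \<omega>) j\<bar>) ` {..<K n + 1})"
    have le: "err n f \<omega> \<le> \<kappa> * ?\<xi> \<omega>" for \<omega>
    proof -
      have "err n f \<omega> \<le> \<kappa> * vec_sup_norm (vec (K n + 1) (weighted_data n (K n) (\<lambda>i. ?u i + ?w \<omega> i))
          - vec (K n + 1) (weighted_data n (K n) ?u))"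
        unfolding err using lam_n by (intro uniform_lipschitzD[OF lip(2) lip_n]) auto
      \<comment> \<open>Linearity of \<open>weighted_data\<close> cancels the contribution of
        \<open>f\<close> here.\<close>
      also have "vec_sup_norm (vec (K n + 1) (weighted_data n (K n) (\<lambda>i. ?u i + ?w \<omega> i))
          - vec (K n + 1) (weighted_data n (K n) ?u)) = ?\<xi> \<omega>"
        unfolding vec_sup_norm_def
        by (intro arg_cong[where f = Max] image_cong) (auto simp: weighted_data_add)
      finally show ?thesis .
    qed
    have [measurable]: "(\<lambda>\<omega>. weighted_data n (K n) (?w \<omega>) j) \<in> borel_measurable M" for j
      unfolding weighted_data_def by measurable
    have [measurable]: "?\<xi> \<in> borel_measurable M"
      by (intro borel_measurable_Max borel_measurable_abs) auto
    have "(\<integral>\<^sup>+\<omega>. ennreal (err n f \<omega>) \<partial>M) \<le> (\<integral>\<^sup>+\<omega>. ennreal \<kappa> * ennreal (?\<xi> \<omega>) \<partial>M)"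
      using lip(1) by (intro nn_integral_mono) (simp only: ennreal_mult'[symmetric] less_imp_le ennreal_leI le)
    also have "\<dots> = ennreal \<kappa> * (\<integral>\<^sup>+\<omega>. ennreal (?\<xi> \<omega>) \<partial>M)"
      by (intro nn_integral_cmult) measurable
    also have "\<dots> \<le> ennreal \<kappa> * ennreal (48 * \<sigma> * sqrt (real (K n) * ln (real n) / real n))"
      by (intro mult_left_mono expectation_Max_weighted_noise[OF n(1) m n(3) \<open>\<sigma> > 0\<close> eps_indep[OF nN] eps_normal[OF nN]]) auto
    also have "\<dots> = ennreal (\<kappa> * 48 * \<sigma> * sqrt (real (K n) * ln (real n) / real n))"
      using lip(1) by (simp add: ennreal_mult'[symmetric] mult.assoc)
    finally show ?thesis using meas by blast
  qed
  \<comment> \<open>The divergence of n / K_n supplies the threshold \<open>P\<close> of the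
    Lipschitz property.\<close>
  have "eventually (\<lambda>n. real P \<le> real n / real (K n)) (inf sequentially (principal N))"
    using K_lim1 by (auto simp: filterlim_at_top)
  moreover have "eventually (\<lambda>n. n \<in> N) (inf sequentially (principal N))"
    by (simp add: eventually_inf_principal)
  ultimately have "eventually (\<lambda>n.
           (\<forall>f\<in>holder_convex r L. err n f \<in> borel_measurable M) \<and>
           (SUP f\<in>holder_convex r L. \<integral>\<^sup>+\<omega>. ennreal (err n f \<omega>) \<partial>M)
             \<le> ennreal (\<kappa> * 48 * \<sigma> * sqrt (real (K n) * ln (real n) / real n)))
         (inf sequentially (principal N))"
    by eventually_elim (use bound in \<open>auto intro!: SUP_least\<close>)
  moreover have "\<kappa> * 48 * \<sigma> > 0" using lip(1) \<open>\<sigma> > 0\<close> by simp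
  ultimately show ?thesis by blast
qed

end
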